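(* Let $G$ be a finite abelian group. The proper power graph $P^\ast(G)$ is connected if and only if $G$ is not a non-cyclic group of order $p^m$ with $p$ a prime and $m \geq 2$ an integer.
   Context: The power graph $P(G)$ of a group $G$ is the simple undirected graph with vertex set $G$ in which two distinct vertices $a,b$ are adjacent if and only if $a\in\langle b\rangle$ or $b\in\langle a\rangle$. The proper power graph $P^\ast(G)$ is the graph obtained from $P(G)$ by deleting the vertex corresponding to the identity element. A graph is connected if each pair of its vertices belongs to a path. *)

theory Defs
  imports
    "HOL-Algebra.Elementary_Groups"
    "HOL-Computational_Algebra.Primes"
    "Graph_Theory.Graph_Theory"
begin

text \<open>
  As usual in this library, a simple undirected graph is a loop-free symmetric digraph:
  an edge between \<open>a\<close> and \<open>b\<close> is the pair of arcs \<open>(a, b)\<close> and \<open>(b, a)\<close>.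
\<close>

definition power_graph :: "('a, 'b) monoid_scheme \<Rightarrow> 'a pair_pre_digraph" where
  "power_graph G =
     \<lparr> pverts = carrier G,
       parcs = {(a, b). a \<in> carrier G \<and> b \<in> carrier G \<and> a \<noteq> b \<and>
                        (a \<in> generate G {b} \<or> b \<in> generate G {a})} \<rparr>"

definition proper_power_graph :: "('a, 'b) monoid_scheme \<Rightarrow> ('a, 'a \<times> 'a) pre_digraph" where
  "proper_power_graph G = pre_digraph.del_vert (with_proj (power_graph G)) \<one>\<^bsub>G\<^esub>"

text \<open>
  The library predicate \<^const>\<open>connected\<close> additionally requires a nonempty vertex set. The
  definition below does not, so that the graph without vertices (the proper power graph of the
  trivial group) is connected. It is meant for symmetric digraphs, on which the two notions
  agree as soon as there is a vertex.
\<close>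

definition path_connected_graph :: "('a, 'b) pre_digraph \<Rightarrow> bool" where
  "path_connected_graph H \<longleftrightarrow>
     (\<forall>u \<in> verts H. \<forall>v \<in> verts H. \<exists>p. vpath p H \<and> u \<in> set p \<and> v \<in> set p)"

lemma pair_bidirected_digraph_power_graph: "pair_bidirected_digraph (power_graph G)"
  by unfold_locales
     (auto simp: power_graph_def symmetric_def intro!: symI)

lemma bidirected_proper_power_graph:
  "wf_digraph (proper_power_graph G)" "symmetric (proper_power_graph G)"
proof -
  interpret pair_bidirected_digraph "power_graph G"
    by (rule pair_bidirected_digraph_power_graph)
  show "wf_digraph (proper_power_graph G)"
    unfolding proper_power_graph_def by (rule wf_digraph_del_vert)
  show "symmetric (proper_power_graph G)"
    by (auto simp: proper_power_graph_def symmetric_def arcs_ends_conv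
        pre_digraph.del_vert_def power_graph_def image_iff intro!: symI)
qed

lemma path_connected_graph_iff_connected:
  assumes "wf_digraph H" "symmetric H" "verts H \<noteq> {}"
  shows "path_connected_graph H \<longleftrightarrow> connected H"
proof -
  interpret wf_digraph H by fact
  have reach: "u \<rightarrow>\<^sup>*\<^bsub>H\<^esub> v" if p: "vpath p H" "u \<in> set p" "v \<in> set p" for p u v
  proof -
    have to_end: "x \<rightarrow>\<^sup>*\<^bsub>H\<^esub> last p" if "x \<in> set p" for x
    proof -
      obtain q r where q: "p = q @ x # r" using split_list \<open>x \<in> set p\<close> by metis
      have "vwalk (x # r) H" using p(1) q vwalkI_append_r[where p = q and q = "x # r" and G = H] by (simp add: vpath_def)
      moreover have "hd (x # r) = x" "last (x # r) = last p" using q by simp_all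
      ultimately show ?thesis unfolding reachable_vwalk_conv by blast
    qed
    show ?thesis
      using reachable_trans[OF to_end[OF p(2)] symmetric_reachable[OF assms(2) to_end[OF p(3)]]] .
  qed
  have path: "\<exists>p. vpath p H \<and> u \<in> set p \<and> v \<in> set p" if uv: "u \<rightarrow>\<^sup>*\<^bsub>H\<^esub> v" for u v
  proof -
    obtain p where p: "vpath p H" "hd p = u" "last p = v"
      using uv unfolding reachable_vpath_conv by blast
    then have "p \<noteq> []" by (auto simp: vpath_def vwalk_def)
    with p show ?thesis by (intro exI[of _ p]) auto
  qed
  have "path_connected_graph H \<longleftrightarrow> (\<forall>u \<in> verts H. \<forall>v \<in> verts H. u \<rightarrow>\<^sup>*\<^bsub>H\<^esub> v)"
    unfolding path_connected_graph_def using reach path by blast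
  then show ?thesis
    using assms reachable_mk_symmetric_eq
    by (simp add: connected_def strongly_connected_def)
qed

end

theory Submission
  imports Defs "HOL-Algebra.Multiplicative_Group" "HOL-Algebra.Sylow"
begin

text \<open>
  If two different primes divide the order, every nontrivial element has a power of prime order,
  and elements \<open>u\<close>, \<open>v\<close> of different prime orders are joined by the path \<open>u, uv, v\<close>; two elements
  of the same prime order are both joined to an element of another prime order. In a \<open>p\<close>-group,
  on the other hand, the set of nontrivial \<open>x\<close> with \<open>u \<in> \<langle>x\<rangle>\<close>, for a fixed \<open>u\<close> of order \<open>p\<close>, is
  closed under adjacency. If the graph is connected, there is thus only one subgroup of order
  \<open>p\<close>, and the fibres of \<open>x \<mapsto> x^p\<close> have at most \<open>p\<close> elements. Then the equation \<open>x^(p^k) = 1\<close> has at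
  most \<open>p^k\<close> solutions for every \<open>k\<close>, and the group is cyclic.
\<close>

section \<open>Cyclic subgroups and elements of prime order\<close>

context group
begin

lemma mem_generate_singleton_iff:
  assumes "finite (carrier G)" "a \<in> carrier G"
  shows "x \<in> generate G {a} \<longleftrightarrow> (\<exists>k::nat. x = a [^] k)"
  using generate_pow_on_finite_carrier[OF assms] by auto

lemma generate_singleton_trans:
  assumes "a \<in> carrier G" "x \<in> generate G {y}" "y \<in> generate G {a}"
  shows "x \<in> generate G {a}"
proof -
  have "generate G {y} \<subseteq> generate G {a}"
    using assms by (intro generate_subgroup_incl generate_is_subgroup) auto
  with assms show ?thesis by blast
qed

lemma cyclic_groupI_ord:
  assumes "finite (carrier G)" "x \<in> carrier G" "ord x = order G"
  shows "cyclic_group G"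
proof -
  have "generate G {x} = carrier G"
    using assms generate_pow_card[of x] generate_incl[of "{x}"]
    by (intro card_subset_eq) (auto simp: order_def)
  then have "subgroup_generated G {x} = G"
    using assms by (simp add: subgroup_generated_def)
  then show "cyclic_group G" using assms cyclic_group_def by blast
qed

lemma cyclic_group_imp_generator:
  assumes "cyclic_group G"
  obtains g where "g \<in> carrier G" "generate G {g} = carrier G"
  using assms unfolding cyclic_group_def
  by (metis Int_insert_right_if1 carrier_subgroup_generated inf_bot_right)

lemma exists_pow_ord_prime:
  assumes "finite (carrier G)" "x \<in> carrier G" "prime r" "r dvd ord x"
  obtains y where "y \<in> generate G {x}" "y \<in> carrier G" "ord y = r"
proof -
  obtain k where k: "ord x = r * k" using assms by blast
  have pos: "ord x > 0" using ord_ge_1[of x] assms by simp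
  with k have "k \<noteq> 0" by auto
  then have "ord (x [^] k) = r" using assms k ord_pow[of x k] by simp
  with that[of "x [^] k"] show ?thesis
    using assms mem_generate_singleton_iff by auto
qed

text \<open>Cauchy's theorem: Sylow's theorem with exponent 1 gives a subgroup of order
  \<open>p\<close>, and each of its nontrivial elements has order \<open>p\<close> by
  Lagrange.\<close>

lemma exists_ord_prime:
  assumes "finite (carrier G)" "prime p" "p dvd order G"
  obtains x where "x \<in> carrier G" "ord x = p"
proof -
  obtain m where "order G = p ^ 1 * m" using assms by auto
  then obtain H where H: "subgroup H G" "card H = p"
    using sylow_thm[OF \<open>prime p\<close> is_group _ assms(1), of 1 m] by auto
  have "card H > 1" using H prime_gt_1_nat assms by simp
  then have "\<not> H \<subseteq> {\<one>}"
    by (metis card.empty card_1_singleton_iff less_irrefl not_less_zero One_nat_def subset_singletonD)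
  then obtain x where x: "x \<in> H" "x \<noteq> \<one>" by blast
  have xG: "x \<in> carrier G" using x H subgroup.subset by blast
  interpret H: group "G\<lparr>carrier := H\<rparr>" by (rule subgroup_imp_group[OF H(1)])
  have "subgroup (generate G {x}) (G\<lparr>carrier := H\<rparr>)"
    using x xG H by (intro subgroup_incl generate_is_subgroup generate_subgroup_incl) auto
  from H.lagrange[OF this] have "ord x dvd p"
    using H(2) generate_pow_card[OF xG] by (auto simp: order_def dvd_def mult.commute)
  then have "ord x = p" using assms(2) x xG ord_eq_1 by (auto simp: prime_nat_iff)
  with that xG show ?thesis by blast
qed

text \<open>The subgroups of a cyclic \<open>p\<close>-group form a chain, at the bottom of which is \<open>\<langle>u\<rangle>\<close>.\<close>

lemma ord_prime_mem_generate:
  assumes "finite (carrier G)" "x \<in> carrier G" "prime p" "ord x = p ^ e"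
    and u: "u \<in> generate G {x}" "u [^] p = \<one>"
    and y: "y \<in> generate G {x}" "y \<noteq> \<one>"
  shows "u \<in> generate G {y}"
proof -
  obtain j k :: nat where j: "u = x [^] j" and k: "y = x [^] k"
    using assms by (auto simp: mem_generate_singleton_iff)
  have "p ^ e dvd j * p"
    using u(2) assms(2,4) j by (simp add: nat_pow_pow pow_eq_id)
  have nk: "\<not> p ^ e dvd k"
    using y(2) assms(2,4) k by (simp add: pow_eq_id)
  then obtain f where e: "e = Suc f" by (cases e) auto
  have fj: "p ^ f dvd j"
    using \<open>p ^ e dvd j * p\<close> prime_gt_0_nat[OF assms(3)] by (simp add: e mult.commute)
  have "gcd k (p ^ e) dvd p ^ e" by simp
  then obtain a where a: "a \<le> e" "gcd k (p ^ e) = p ^ a"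
    using divides_primepow_nat[OF assms(3)] by blast
  \<comment> \<open>A gcd of \<open>p ^ e\<close> would make \<open>y\<close> trivial. Hence
    \<open>a \<le> f\<close>, and \<open>p ^ a\<close> divides \<open>p ^ f\<close>, which divides
    \<open>j\<close>.\<close>
  have "a \<noteq> e" using nk a by (metis gcd_dvd1)
  then have "p ^ a dvd j" using a(1) e fj by (meson dvd_trans le_imp_power_dvd le_neq_implies_less less_Suc_eq_le)
  then obtain c where c: "j = p ^ a * c" by blast
  have "k \<noteq> 0" using nk by (metis dvd_0_right)
  \<comment> \<open>By Bezout, \<open>y [^] s\<close> equals \<open>x [^] (p ^ a)\<close>, because
    \<open>x [^] (p ^ e)\<close> is trivial. Raising this to the power \<open>c\<close> gives
    \<open>u\<close>.\<close>
  then obtain s t where st: "k * s = p ^ e * t + p ^ a"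
    using bezout_nat[of k "p ^ e"] a by auto
  have "y [^] (s * c) = x [^] (p ^ e * (t * c) + j)"
    using st c assms(2) by (simp add: k nat_pow_pow distrib_right flip: mult.assoc)
  also have "\<dots> = (x [^] ord x) [^] (t * c) \<otimes> u"
    using assms(2) by (simp add: nat_pow_mult[symmetric] nat_pow_pow assms(4) j)
  also have "\<dots> = u" using assms(2) j by simp
  finally show ?thesis
    using assms(1,2) k by (auto simp: mem_generate_singleton_iff)
qed

end

section \<open>Power maps and coprime orders in abelian groups\<close>

context comm_group
begin

text \<open>Induction on \<open>k\<close>: raising to the power \<open>p\<close> maps the solutions
  for \<open>p ^ Suc k\<close> to those for \<open>p ^ k\<close>, and each fibre has at most
  \<open>p\<close> elements.\<close>

lemma card_pow_kernel_le:
  assumes "finite (carrier G)" "card {x \<in> carrier G. x [^] (p::nat) = \<one>} \<le> p"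
  shows "card {x \<in> carrier G. x [^] (p ^ k) = \<one>} \<le> p ^ k"
proof (induction k)
  case 0
  have "{x \<in> carrier G. x [^] (p ^ 0) = \<one>} = {\<one>}" by auto
  then show ?case by simp
next
  case (Suc k)
  let ?K = "{x \<in> carrier G. x [^] p = \<one>}"
  let ?B = "{x \<in> carrier G. x [^] (p ^ k) = \<one>}"
  define F where "F y = {x \<in> carrier G. x [^] p = y}" for y
  have fibre: "card (F y) \<le> p" for y
  proof (cases "F y = {}")
    case False
    then obtain z where z: "z \<in> carrier G" "z [^] p = y" by (auto simp: F_def)
    \<comment> \<open>A nonempty fibre lies in the coset of the kernel \<open>?K\<close> through any
      of its elements \<open>z\<close>.\<close>
    have "F y \<subseteq> (\<lambda>w. z \<otimes> w) ` ?K"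
    proof
      fix x assume "x \<in> F y"
      then have x: "x \<in> carrier G" "x [^] p = y" by (auto simp: F_def)
      have "inv z \<otimes> x \<in> ?K" using x z by (auto simp: pow_mult_distrib m_comm nat_pow_inv)
      moreover have "x = z \<otimes> (inv z \<otimes> x)" using x z by (simp flip: m_assoc)
      ultimately show "x \<in> (\<lambda>w. z \<otimes> w) ` ?K" by blast
    qed
    then have "card (F y) \<le> card ?K" using assms(1) by (simp add: surj_card_le)
    with assms(2) show ?thesis by simp
  qed simp
  have "{x \<in> carrier G. x [^] (p ^ Suc k) = \<one>} \<subseteq> (\<Union>y\<in>?B. F y)"
    by (auto simp: F_def nat_pow_pow)
  then have "card {x \<in> carrier G. x [^] (p ^ Suc k) = \<one>} \<le> card (\<Union>y\<in>?B. F y)"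
    using assms(1) by (intro card_mono) (auto simp: F_def)
  also have "\<dots> \<le> (\<Sum>y\<in>?B. card (F y))" using assms(1) by (intro card_UN_le) auto
  also have "\<dots> \<le> card ?B * p" using sum_bounded_above[of ?B "\<lambda>y. card (F y)" p] fibre by simp
  also have "\<dots> \<le> p ^ Suc k" using Suc.IH by simp
  finally show ?case .
qed

text \<open>With \<open>m = Suc k\<close>, at most \<open>p ^ k\<close> elements satisfy
  \<open>x [^] (p ^ k) = \<one>\<close>, which is not all of them. Any other element has an order
  dividing \<open>p ^ m\<close> but not \<open>p ^ k\<close>, so it generates the group.\<close>

lemma cyclic_group_if_card_pow_kernel_le:
  assumes "finite (carrier G)" "prime p" "order G = p ^ m"
    and "card {x \<in> carrier G. x [^] p = \<one>} \<le> p"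
  shows "cyclic_group G"
proof (cases m)
  case 0
  then show ?thesis using cyclic_groupI_ord[of \<one>] assms by simp
next
  case (Suc k)
  have "card {x \<in> carrier G. x [^] (p ^ k) = \<one>} \<le> p ^ k"
    by (rule card_pow_kernel_le) fact+
  also have "\<dots> < card (carrier G)"
    using assms Suc prime_gt_1_nat[of p] by (simp add: order_def)
  finally have "{x \<in> carrier G. x [^] (p ^ k) = \<one>} \<noteq> carrier G" by auto
  then obtain x where x: "x \<in> carrier G" "\<not> ord x dvd p ^ k" by (metis (mono_tags, lifting) Collect_cong Collect_mem_eq pow_eq_id)
  obtain i where i: "i \<le> m" "ord x = p ^ i"
    using ord_dvd_group_order[OF x(1)] assms(2,3) by (auto simp: divides_primepow_nat)
  with x(2) Suc have "i = m" by (metis le_SucE le_imp_power_dvd)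
  with i assms x show ?thesis using cyclic_groupI_ord[of x] by simp
qed

text \<open>Bezout yields an exponent that is 1 modulo \<open>ord u\<close> and 0 modulo
  \<open>ord v\<close>; it turns \<open>u \<otimes> v\<close> into \<open>u\<close>.\<close>

lemma coprime_ord_mem_generate_mult:
  assumes "finite (carrier G)" "u \<in> carrier G" "v \<in> carrier G" "coprime (ord u) (ord v)"
  shows "u \<in> generate G {u \<otimes> v}"
proof -
  \<comment> \<open>The value 0 of \<open>ord\<close> stands for infinite order and is excluded by
    finiteness.\<close>
  have "ord v \<noteq> 0" using ord_ge_1[of v] assms by simp
  then obtain s t where st: "ord v * s = ord u * t + 1"
    using bezout_nat[of "ord v" "ord u"] assms(4) by (auto simp: coprime_iff_gcd_eq_1 gcd.commute)
  have "u [^] (ord v * s) = u"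
    unfolding st using assms by (simp add: nat_pow_mult[symmetric] nat_pow_pow[symmetric])
  moreover have "v [^] (ord v * s) = \<one>"
    using assms by (simp add: nat_pow_pow[symmetric])
  ultimately have "(u \<otimes> v) [^] (ord v * s) = u"
    using assms by (simp add: pow_mult_distrib m_comm)
  then show ?thesis using assms by (metis m_closed mem_generate_singleton_iff)
qed

end

section \<open>Reachability in the proper power graph\<close>

lemma verts_proper_power_graph: "verts (proper_power_graph G) = carrier G - {\<one>\<^bsub>G\<^esub>}"
  by (simp add: proper_power_graph_def pre_digraph.del_vert_def power_graph_def)

lemma dominates_proper_power_graph:
  "a \<rightarrow>\<^bsub>proper_power_graph G\<^esub> b \<longleftrightarrow>
     a \<in> carrier G - {\<one>\<^bsub>G\<^esub>} \<and> b \<in> carrier G - {\<one>\<^bsub>G\<^esub>} \<and> a \<noteq> b \<and>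
     (a \<in> generate G {b} \<or> b \<in> generate G {a})"
  by (auto simp: proper_power_graph_def arcs_ends_conv pre_digraph.del_vert_def power_graph_def
      image_iff)

text \<open>Reachability can be chained and inducted on. The graph without vertices is split off
  because \<open>connected\<close> requires a vertex; there both sides hold vacuously.\<close>

lemma path_connected_proper_power_graph_iff:
  "path_connected_graph (proper_power_graph G) \<longleftrightarrow>
     (\<forall>u \<in> carrier G - {\<one>\<^bsub>G\<^esub>}. \<forall>v \<in> carrier G - {\<one>\<^bsub>G\<^esub>}. u \<rightarrow>\<^sup>*\<^bsub>proper_power_graph G\<^esub> v)"
proof -
  interpret wf_digraph "proper_power_graph G" by (rule bidirected_proper_power_graph)
  show ?thesis
    using path_connected_graph_iff_connected[OF bidirected_proper_power_graph, of G]
      reachable_mk_symmetric_eq[OF bidirected_proper_power_graph(2)]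
    by (cases "carrier G - {\<one>\<^bsub>G\<^esub>} = {}")
      (auto simp: path_connected_graph_def connected_def strongly_connected_def
        verts_proper_power_graph)
qed

context group
begin

text \<open>The two elements are adjacent unless they coincide, and reachability is reflexive on
  vertices.\<close>

lemma reachable_if_mem_generate:
  assumes "x \<in> carrier G - {\<one>}" "y \<in> carrier G - {\<one>}" "y \<in> generate G {x}"
  shows "x \<rightarrow>\<^sup>*\<^bsub>proper_power_graph G\<^esub> y" "y \<rightarrow>\<^sup>*\<^bsub>proper_power_graph G\<^esub> x"
proof -
  interpret wf_digraph "proper_power_graph G" by (rule bidirected_proper_power_graph)
  show xy: "x \<rightarrow>\<^sup>*\<^bsub>proper_power_graph G\<^esub> y"
  proof (cases "x = y")
    case True
    then show ?thesis using assms by (auto simp: verts_proper_power_graph)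
  next
    case False
    then show ?thesis using assms by (intro reachable_adjI) (auto simp: dominates_proper_power_graph)
  qed
  show "y \<rightarrow>\<^sup>*\<^bsub>proper_power_graph G\<^esub> x"
    by (rule symmetric_reachable[OF bidirected_proper_power_graph(2) xy])
qed

text \<open>A generator is adjacent to every other vertex, so any two vertices are joined through
  it.\<close>

lemma path_connected_if_cyclic:
  assumes "cyclic_group G"
  shows "path_connected_graph (proper_power_graph G)"
proof -
  interpret wf_digraph "proper_power_graph G" by (rule bidirected_proper_power_graph)
  obtain g where g: "g \<in> carrier G" "generate G {g} = carrier G"
    using cyclic_group_imp_generator[OF assms] .
  show ?thesis unfolding path_connected_proper_power_graph_iff
  proof (intro ballI)
    fix u v assume uv: "u \<in> carrier G - {\<one>}" "v \<in> carrier G - {\<one>}"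
    \<comment> \<open>A nontrivial \<open>u\<close> rules out the identity as generator, so
      \<open>g\<close> is a vertex.\<close>
    have "g \<noteq> \<one>" using uv g generate_one by auto
    with g have "g \<in> carrier G - {\<one>}" by simp
    from reachable_if_mem_generate(2)[OF this uv(1)] reachable_if_mem_generate(1)[OF this uv(2)]
    show "u \<rightarrow>\<^sup>*\<^bsub>proper_power_graph G\<^esub> v" using uv g reachable_trans by auto
  qed
qed

text \<open>Containing \<open>u\<close> in the generated subgroup passes from \<open>x\<close> to an
  adjacent \<open>y\<close>: by transitivity if \<open>x\<close> is a power of \<open>y\<close>, and
  by \<open>ord_prime_mem_generate\<close> if \<open>y\<close> is a power of \<open>x\<close>. The
  latter uses that the identity is deleted, so that \<open>y\<close> is nontrivial.\<close>

lemma ord_prime_mem_generate_reachable: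
  assumes "finite (carrier G)" "prime p" "order G = p ^ m"
    and u: "u [^] p = \<one>"
    and reach: "u \<rightarrow>\<^sup>*\<^bsub>proper_power_graph G\<^esub> v"
  shows "u \<in> generate G {v}"
proof -
  interpret wf_digraph "proper_power_graph G" by (rule bidirected_proper_power_graph)
  from reach show ?thesis
  proof (induction rule: reachable_induct)
    case base
    then show ?case by (auto intro: generate.incl)
  next
    case (step x y)
    from step.hyps(2) have xy: "x \<in> carrier G" "y \<in> carrier G" "y \<noteq> \<one>"
      and adj: "x \<in> generate G {y} \<or> y \<in> generate G {x}"
      by (auto simp: dominates_proper_power_graph)
    obtain e where "ord x = p ^ e"
      using ord_dvd_group_order[OF xy(1)] assms(2,3) by (auto simp: divides_primepow_nat)
    then show ?case
      using adj xy assms(1,2) u step.IH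
      by (metis generate_singleton_trans ord_prime_mem_generate)
  qed
qed

end

section \<open>Connectedness for abelian groups\<close>

context comm_group
begin

text \<open>Connectedness puts all solutions of \<open>x [^] p = \<one>\<close> into the subgroup
  generated by one nontrivial solution \<open>v\<close>, which has at most \<open>p\<close>
  elements.\<close>

lemma cyclic_if_path_connected:
  assumes fin: "finite (carrier G)" and p: "prime p" "order G = p ^ m"
    and conn: "path_connected_graph (proper_power_graph G)"
  shows "cyclic_group G"
proof -
  let ?K = "{x \<in> carrier G. x [^] p = \<one>}"
  have "card ?K \<le> p"
  proof (cases "?K \<subseteq> {\<one>}")
    case True
    then have "card ?K \<le> card {\<one>}" by (intro card_mono) auto
    also have "\<dots> \<le> p" using prime_gt_0_nat[OF p(1)] by simp
    finally show ?thesis .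
  next
    case False
    then obtain v where v: "v \<in> carrier G" "v [^] p = \<one>" "v \<noteq> \<one>" by auto
    have "ord v dvd p" using v by (simp add: pow_eq_id)
    then have "ord v \<le> p" using prime_gt_0_nat[OF p(1)] by (simp add: dvd_imp_le)
    have "?K \<subseteq> generate G {v}"
    proof
      fix u assume u: "u \<in> ?K"
      show "u \<in> generate G {v}"
      proof (cases "u = \<one>")
        case False
        then have "u \<rightarrow>\<^sup>*\<^bsub>proper_power_graph G\<^esub> v"
          using conn u v unfolding path_connected_proper_power_graph_iff by blast
        then show ?thesis using ord_prime_mem_generate_reachable[OF fin p] u by blast
      qed (simp add: generate.one)
    qed
    then have "card ?K \<le> card (generate G {v})"
      using fin v generate_incl[of "{v}"] by (intro card_mono) (auto intro: finite_subset)
    with \<open>ord v \<le> p\<close> show ?thesis using generate_pow_card[OF v(1)] by simp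
  qed
  then show ?thesis by (rule cyclic_group_if_card_pow_kernel_le[OF fin p])
qed

lemma reachable_if_coprime_ord:
  assumes fin: "finite (carrier G)"
    and uv: "u \<in> carrier G - {\<one>}" "v \<in> carrier G - {\<one>}" "coprime (ord u) (ord v)"
  shows "u \<rightarrow>\<^sup>*\<^bsub>proper_power_graph G\<^esub> v"
proof -
  interpret wf_digraph "proper_power_graph G" by (rule bidirected_proper_power_graph)
  have u: "u \<in> generate G {u \<otimes> v}"
    using coprime_ord_mem_generate_mult[OF fin, of u v] uv by auto
  have v: "v \<in> generate G {u \<otimes> v}"
    using coprime_ord_mem_generate_mult[OF fin, of v u] uv
    by (auto simp: m_comm coprime_commute)
  \<comment> \<open>The middle vertex survives the deletion of the identity, since its powers
    include the nontrivial \<open>u\<close>.\<close>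
  have "u \<otimes> v \<noteq> \<one>" using u uv(1) generate_one by (metis DiffD2)
  then have "u \<otimes> v \<in> carrier G - {\<one>}" using uv by auto
  then show ?thesis
    using reachable_if_mem_generate(2)[OF _ uv(1) u] reachable_if_mem_generate(1)[OF _ uv(2) v]
      reachable_trans by blast
qed

lemma path_connected_if_two_primes:
  assumes fin: "finite (carrier G)"
    and pq: "prime p" "prime q" "p \<noteq> q" "p dvd order G" "q dvd order G"
  shows "path_connected_graph (proper_power_graph G)"
proof -
  interpret wf_digraph "proper_power_graph G" by (rule bidirected_proper_power_graph)
  let ?R = "\<lambda>u v. u \<rightarrow>\<^sup>*\<^bsub>proper_power_graph G\<^esub> v"
  have nontriv: "y \<in> carrier G - {\<one>}" if "y \<in> carrier G" "prime (ord y)" for y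
    using that by auto
  have prime_elem: "\<exists>y \<in> carrier G. prime (ord y) \<and> ?R x y" if x: "x \<in> carrier G - {\<one>}" for x
  proof -
    have "ord x \<noteq> 1" using x ord_eq_1 by auto
    then obtain r where r: "prime r" "r dvd ord x" using prime_factor_nat by blast
    obtain y where y: "y \<in> generate G {x}" "y \<in> carrier G" "ord y = r"
      using exists_pow_ord_prime[OF fin _ r] x by auto
    with r nontriv[of y] reachable_if_mem_generate(1)[OF x _ y(1)] show ?thesis by auto
  qed
  have other: "?R u v" if u: "u \<in> carrier G" "prime (ord u)" and v: "v \<in> carrier G" "prime (ord v)"
    and "ord u \<noteq> ord v" for u v
    using that nontriv by (intro reachable_if_coprime_ord[OF fin] primes_coprime) auto
  have prime_conn: "?R u v"
    if u: "u \<in> carrier G" "prime (ord u)" and v: "v \<in> carrier G" "prime (ord v)" for u v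
  proof (cases "ord u = ord v")
    case True
    \<comment> \<open>At least one of \<open>p\<close> and \<open>q\<close> differs from the common
      order; an element \<open>w\<close> of that order serves as detour.\<close>
    obtain t where t: "prime t" "t dvd order G" "t \<noteq> ord u" using pq by metis
    obtain w where w: "w \<in> carrier G" "ord w = t"
      using exists_ord_prime[OF fin t(1,2)] .
    have "?R u w" "?R w v" using other u v w t True by auto
    then show ?thesis by (rule reachable_trans)
  qed (use other that in blast)
  show ?thesis unfolding path_connected_proper_power_graph_iff
  proof (intro ballI)
    fix x y assume xy: "x \<in> carrier G - {\<one>}" "y \<in> carrier G - {\<one>}"
    obtain u where u: "u \<in> carrier G" "prime (ord u)" "?R x u" using prime_elem[OF xy(1)] by blast
    obtain v where v: "v \<in> carrier G" "prime (ord v)" "?R y v" using prime_elem[OF xy(2)] by blast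
    have "?R v y" by (rule symmetric_reachable[OF bidirected_proper_power_graph(2) v(3)])
    with u v prime_conn show "?R x y" by (meson reachable_trans)
  qed
qed

text \<open>Cauchy's theorem for the prime \<open>order G\<close> itself gives a generator.\<close>

lemma cyclic_if_order_prime:
  assumes "finite (carrier G)" "prime (order G)"
  shows "cyclic_group G"
  using exists_ord_prime[OF assms dvd_refl] cyclic_groupI_ord[OF assms(1)] by metis

end

theorem theorem3p5:
  fixes G :: "('a, 'b) monoid_scheme"
  assumes "comm_group G" and "finite (carrier G)"
  shows "path_connected_graph (proper_power_graph G) \<longleftrightarrow>
    \<not> (\<not> cyclic_group G \<and>
       (\<exists>(p::nat) (m::nat). prime p \<and> 2 \<le> m \<and> order G = p ^ m))"
proof -
  interpret comm_group G by fact
  \<comment> \<open>An order that is not \<open>p ^ m\<close> with \<open>m \<ge> 2\<close> has two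
    prime divisors, or is 1 or a prime. In the last two cases the group is cyclic.\<close>
  have "path_connected_graph (proper_power_graph G)"
    if no: "\<not> (\<exists>(p::nat) (m::nat). prime p \<and> 2 \<le> m \<and> order G = p ^ m)"
  proof (cases "\<exists>p q. prime p \<and> prime q \<and> p \<noteq> q \<and> p dvd order G \<and> q dvd order G")
    case True
    then show ?thesis using path_connected_if_two_primes[OF assms(2)] by blast
  next
    case False
    have pos: "order G > 0" using assms(2) order_gt_0_iff_finite by blast
    have "cyclic_group G"
    proof (cases "order G = 1")
      case True
      then show ?thesis using cyclic_groupI_ord[OF assms(2), of "\<one>\<^bsub>G\<^esub>"] by simp
    next
      case not1: False
      then obtain p where p: "prime p" "p dvd order G" using prime_factor_nat by blast
      have "prime_factors (order G) = {p}"
        using False p pos by (auto simp: in_prime_factors_iff)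
      then have eq: "order G = p ^ multiplicity p (order G)"
        using prime_factorization_nat[OF pos] by simp
      with no p have "\<not> 2 \<le> multiplicity p (order G)" by blast
      moreover have "multiplicity p (order G) \<noteq> 0" using eq not1 by (metis power_0)
      ultimately have "multiplicity p (order G) = 1" by linarith
      then have "order G = p" using eq by simp
      with p show ?thesis using cyclic_if_order_prime[OF assms(2)] by simp
    qed
    then show ?thesis by (rule path_connected_if_cyclic)
  qed
  \<comment> \<open>For the remaining orders \<open>p ^ m\<close>, connectedness is equivalent to
    being cyclic.\<close>
  then show ?thesis
    using path_connected_if_cyclic cyclic_if_path_connected[OF assms(2)] by blast
qed

end
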